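(* Let $L>0$ and let $f\in\mathcal{F}^1_L(\mathbb{R}^n)$ with a minimizer $x^\star$. For any step size $0<s\le 1/(3L)$, the iterates $\{x_k\}_{k=0}^\infty$ generated by NAG-C from any initial point $x_0=y_0\in\mathbb{R}^n$, namely $$y_{k+1}=x_k-s\nabla f(x_k),\qquad x_{k+1}=y_{k+1}+\frac{k}{k+3}\,(y_{k+1}-y_k)\qquad(k\ge 0),$$ obey $$\min_{0\le i\le k}\|\nabla f(x_i)\|^2\le \frac{8568\,\|x_0-x^\star\|^2}{s^2(k+1)^3}$$ for all $k\ge 0$. In addition, $$f(x_k)-f(x^\star)\le \frac{119\,\|x_0-x^\star\|^2}{s(k+1)^2}$$ for all $k\ge 0$.
   Context: $\|\cdot\|$ is the Euclidean norm. $\mathcal{F}^1_L(\mathbb{R}^n)$ is the class of differentiable convex functions $f:\mathbb{R}^n\to\mathbb{R}$ whose gradient is $L$-Lipschitz: $\|\nabla f(x)-\nabla f(y)\|\le L\|x-y\|$ for all $x,y\in\mathbb{R}^n$. *)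

theory Defs
  imports "HOL-Analysis.Analysis"
begin

definition gradient :: "('a::real_inner \<Rightarrow> real) \<Rightarrow> 'a \<Rightarrow> 'a" where
  "gradient f x = (THE D. GDERIV f x :> D)"

lemma gradient_eqI:
  assumes "GDERIV f x :> D"
  shows "gradient f x = D"
  unfolding gradient_def
proof (rule the_equality)
  show "GDERIV f x :> D" by fact
next
  fix E assume "GDERIV f x :> E"
  with assms have "(\<lambda>h. h \<bullet> E) = (\<lambda>h. h \<bullet> D)"
    unfolding gderiv_def by (rule has_derivative_unique[rotated])
  then have "\<And>h. h \<bullet> E = h \<bullet> D" by metis
  then show "E = D" by (metis vector_eq_rdot inner_commute)
qed

lemma differentiable_imp_GDERIV_gradient:
  fixes f :: "'a::euclidean_space \<Rightarrow> real"
  assumes "f differentiable at x"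
  shows "GDERIV f x :> gradient f x"
proof -
  from assms obtain f' where f': "(f has_derivative f') (at x)"
    unfolding differentiable_def by blast
  then interpret linear f' by (rule has_derivative_linear)
  have "f' h = h \<bullet> adjoint f' 1" for h
    using adjoint_works[OF linear_axioms, of h 1] by simp
  then have "f' = (\<lambda>h. h \<bullet> adjoint f' 1)" by blast
  with f' have "GDERIV f x :> adjoint f' 1"
    unfolding gderiv_def by metis
  then show ?thesis by (simp add: gradient_eqI)
qed

definition F1_class :: "real \<Rightarrow> ('a::euclidean_space \<Rightarrow> real) set" where
  "F1_class L = {f. f differentiable_on UNIV \<and> convex_on UNIV f
     \<and> (\<forall>x y. norm (gradient f x - gradient f y) \<le> L * norm (x - y))}"

end

theory Submission
  imports Defs
begin

text \<open>
  Put \<open>t\<^sub>k = (k + 2) / 2\<close> and \<open>u\<^sub>k = t\<^sub>k x\<^sub>k - (t\<^sub>k - 1) y\<^sub>k - x\<^sup>\<star>\<close>; the momentum coefficient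
  \<open>k / (k + 3) = (t\<^sub>k - 1) / t\<^sub>k\<^sub>+\<^sub>1\<close> makes \<open>u\<^sub>k\<^sub>+\<^sub>1 = u\<^sub>k - s t\<^sub>k \<nabla>f(x\<^sub>k)\<close>. Since \<open>s \<le> 1 / (3 L)\<close>, a gradient
  step decreases \<open>f\<close> by at least \<open>(2/3) s \<parallel>\<nabla>f(x\<^sub>k)\<parallel>\<^sup>2\<close>, which is more than the \<open>(1/2) s \<parallel>\<nabla>f(x\<^sub>k)\<parallel>\<^sup>2\<close>
  that Nesterov's argument with the energy
  \<open>2 s (t\<^sub>k\<^sup>2 - t\<^sub>k) (f(y\<^sub>k) - f(x\<^sup>\<star>)) + \<parallel>u\<^sub>k\<parallel>\<^sup>2\<close> consumes. The surplus leaves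
  \<open>(1/3) s\<^sup>2 t\<^sub>k\<^sup>2 \<parallel>\<nabla>f(x\<^sub>k)\<parallel>\<^sup>2\<close> in every step: summing it bounds the smallest gradient, and a single
  term of it controls \<open>f(x\<^sub>k) - f(y\<^sub>k\<^sub>+\<^sub>1) \<le> s \<parallel>\<nabla>f(x\<^sub>k)\<parallel>\<^sup>2\<close>.
\<close>

lemma has_real_derivative_along_line:
  fixes f :: "'a::euclidean_space \<Rightarrow> real"
  assumes "f differentiable_on UNIV"
  shows "((\<lambda>t. f (x + t *\<^sub>R h)) has_real_derivative h \<bullet> gradient f (x + t *\<^sub>R h)) (at t)"
proof -
  have "GDERIV f (x + t *\<^sub>R h) :> gradient f (x + t *\<^sub>R h)"
    using assms by (intro differentiable_imp_GDERIV_gradient) (simp add: differentiable_on_def)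
  then have D: "(f has_derivative (\<lambda>v. v \<bullet> gradient f (x + t *\<^sub>R h))) (at (x + t *\<^sub>R h))"
    by (simp add: gderiv_def)
  have "((\<lambda>t. x + t *\<^sub>R h) has_derivative (\<lambda>t. t *\<^sub>R h)) (at t)"
    by (auto intro!: derivative_eq_intros)
  from has_derivative_compose[OF this D] show ?thesis
    by (simp add: has_field_derivative_def mult_commute_abs)
qed

text \<open>Restricted to the line through \<open>x\<close> and \<open>z\<close>, \<open>f\<close>
  is a convex function of one real variable; it lies above its tangent at parameter 0, and parameter
  1 is the point \<open>z\<close>.\<close>

lemma convex_on_gradient_le:
  fixes f :: "'a::euclidean_space \<Rightarrow> real"
  assumes "f differentiable_on UNIV" and "convex_on UNIV f"
  shows "f x - f z \<le> gradient f x \<bullet> (x - z)"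
proof -
  let ?\<phi> = "\<lambda>t. f (x + t *\<^sub>R (z - x))"
  have "convex_on UNIV ?\<phi>"
  proof (rule convex_onI)
    fix t a b :: real
    assume "0 < t" "t < 1"
    have "x + ((1 - t) *\<^sub>R a + t *\<^sub>R b) *\<^sub>R (z - x)
        = (1 - t) *\<^sub>R (x + a *\<^sub>R (z - x)) + t *\<^sub>R (x + b *\<^sub>R (z - x))"
      by (simp add: algebra_simps)
    then show "?\<phi> ((1 - t) *\<^sub>R a + t *\<^sub>R b) \<le> (1 - t) * ?\<phi> a + t * ?\<phi> b"
      using convex_onD[OF assms(2), of t "x + a *\<^sub>R (z - x)" "x + b *\<^sub>R (z - x)"] \<open>0 < t\<close> \<open>t < 1\<close>
      by simp
  qed simp
  then have "?\<phi> 1 - ?\<phi> 0 \<ge> ((z - x) \<bullet> gradient f x) * (1 - 0)"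
    using has_real_derivative_along_line[OF assms(1), of x "z - x" 0]
    by (intro convex_on_imp_above_tangent[of UNIV]) auto
  then show ?thesis
    by (simp add: inner_diff_left inner_diff_right inner_commute)
qed

text \<open>By the mean value theorem the change of \<open>f\<close> is
  \<open>- s * (g \<bullet> g')\<close>, with \<open>g'\<close> the gradient at a point of the step,
  so within \<open>s * L * norm g\<close> of \<open>g\<close>. Integrating along the step would give
  the sharper factor \<open>1 - s * L / 2\<close>; the cruder one is already at least 2/3 when
  \<open>s * L \<le> 1/3\<close>.\<close>

lemma gradient_step_decrease:
  fixes f :: "'a::euclidean_space \<Rightarrow> real"
  assumes diff: "f differentiable_on UNIV"
    and lip: "\<And>x y. norm (gradient f x - gradient f y) \<le> L * norm (x - y)"
    and "0 \<le> L" and "0 \<le> s"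
  shows "f (x - s *\<^sub>R gradient f x) \<le> f x - s * (1 - s * L) * (norm (gradient f x))\<^sup>2"
proof -
  define g where "g = gradient f x"
  let ?\<phi> = "\<lambda>t. f (x + t *\<^sub>R (- (s *\<^sub>R g)))"
  have "\<exists>t>0. t < 1 \<and> ?\<phi> 1 - ?\<phi> 0 = (1 - 0) * (- (s *\<^sub>R g) \<bullet> gradient f (x + t *\<^sub>R (- (s *\<^sub>R g))))"
    by (rule MVT2[OF zero_less_one has_real_derivative_along_line[OF diff]])
  then obtain t where t: "0 < t" "t < 1"
    and eq: "f (x - s *\<^sub>R g) - f x = - s * (g \<bullet> gradient f (x - (t * s) *\<^sub>R g))"
    by auto
  define g' where "g' = gradient f (x - (t * s) *\<^sub>R g)"
  have "norm (g - g') \<le> L * (t * s * norm g)"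
    using lip[of x "x - (t * s) *\<^sub>R g"] t \<open>0 \<le> s\<close> by (simp add: g_def g'_def)
  also have "\<dots> \<le> L * (s * norm g)"
    using t \<open>0 \<le> s\<close> \<open>0 \<le> L\<close> by (intro mult_left_mono mult_right_mono mult_left_le_one_le) auto
  finally have "norm g * norm (g - g') \<le> norm g * (L * (s * norm g))"
    by (intro mult_left_mono) auto
  then have "g \<bullet> (g - g') \<le> s * L * (norm g)\<^sup>2"
    using norm_cauchy_schwarz[of g "g - g'"] by (simp add: power2_eq_square algebra_simps)
  then have "(1 - s * L) * (norm g)\<^sup>2 \<le> g \<bullet> g'"
    by (simp add: inner_diff_right power2_norm_eq_inner algebra_simps)
  then have "s * ((1 - s * L) * (norm g)\<^sup>2) \<le> s * (g \<bullet> g')"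
    using \<open>0 \<le> s\<close> by (rule mult_left_mono)
  with eq show ?thesis
    by (simp add: g_def g'_def mult.assoc)
qed

text \<open>Adding \<open>dy\<close> with weight \<open>t - 1\<close> to \<open>dz\<close> assembles
  the inner product of \<open>g\<close> with the vector \<open>u\<close> below. After scaling by
  \<open>2 * s * t\<close>, this cancels the cross term of the expanded square, whose quadratic term
  turns the gain \<open>2 * c\<close> into \<open>2 * c - 1\<close>.\<close>

lemma nesterov_energy_step:
  fixes x y z g :: "'a::real_inner" and \<delta> \<delta>' s t c :: real
  assumes "0 \<le> s" and "1 \<le> t"
    and dy: "\<delta>' - \<delta> \<le> g \<bullet> (x - y) - c * s * (norm g)\<^sup>2"
    and dz: "\<delta>' \<le> g \<bullet> (x - z) - c * s * (norm g)\<^sup>2"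
  shows "2 * s * t\<^sup>2 * \<delta>' + (norm (t *\<^sub>R x - (t - 1) *\<^sub>R y - z - (s * t) *\<^sub>R g))\<^sup>2
           + (2 * c - 1) * s\<^sup>2 * t\<^sup>2 * (norm g)\<^sup>2
       \<le> 2 * s * (t\<^sup>2 - t) * \<delta> + (norm (t *\<^sub>R x - (t - 1) *\<^sub>R y - z))\<^sup>2"
proof -
  define u where "u = t *\<^sub>R x - (t - 1) *\<^sub>R y - z"
  have "(t - 1) * (\<delta>' - \<delta>) + \<delta>'
      \<le> (t - 1) * (g \<bullet> (x - y) - c * s * (norm g)\<^sup>2) + (g \<bullet> (x - z) - c * s * (norm g)\<^sup>2)"
    using \<open>1 \<le> t\<close> by (intro add_mono mult_left_mono dy dz) auto
  also have "\<dots> = g \<bullet> u - t * c * s * (norm g)\<^sup>2"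
    by (simp add: u_def inner_diff_right algebra_simps)
  finally have "t * \<delta>' - (t - 1) * \<delta> \<le> g \<bullet> u - t * c * s * (norm g)\<^sup>2"
    by (simp add: algebra_simps)
  then have "2 * s * t * (t * \<delta>' - (t - 1) * \<delta>) \<le> 2 * s * t * (g \<bullet> u - t * c * s * (norm g)\<^sup>2)"
    using \<open>0 \<le> s\<close> \<open>1 \<le> t\<close> by (intro mult_left_mono) auto
  moreover have "(norm (u - (s * t) *\<^sub>R g))\<^sup>2
      = (norm u)\<^sup>2 - 2 * (s * t) * (g \<bullet> u) + (s * t)\<^sup>2 * (norm g)\<^sup>2"
    unfolding power2_norm_eq_inner
    by (simp add: inner_diff_left inner_diff_right inner_commute power2_eq_square algebra_simps)
  ultimately show ?thesis
    unfolding u_def[symmetric] by (simp add: power2_eq_square algebra_simps)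
qed

text \<open>Multiplying the extrapolation by \<open>t'\<close> clears its denominator. In the
  application \<open>x - y'\<close> is the gradient step \<open>s *\<^sub>R g k\<close>.\<close>

lemma nesterov_momentum_step:
  fixes x x' y y' z :: "'a::real_vector" and t t' :: real
  assumes "t' \<noteq> 0" and "x' = y' + ((t - 1) / t') *\<^sub>R (y' - y)"
  shows "t' *\<^sub>R x' - (t' - 1) *\<^sub>R y' - z = t *\<^sub>R x - (t - 1) *\<^sub>R y - z - t *\<^sub>R (x - y')"
proof -
  have "t' *\<^sub>R x' = t' *\<^sub>R y' + (t - 1) *\<^sub>R (y' - y)"
    using assms by (simp add: scaleR_add_right)
  then show ?thesis
    by (simp add: algebra_simps)
qed

text \<open>From \<open>k\<close> to \<open>k + 1\<close> the left side grows by
  \<open>k^2 + 3 * k + 7/3\<close>, less than the new summand \<open>(k + 3)^2\<close>.\<close>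

lemma sum_of_shifted_squares_ge:
  "(real k + 1) ^ 3 / 3 \<le> (\<Sum>i\<le>k. (real i + 2)\<^sup>2)"
proof (induction k)
  case (Suc k)
  have "(real (Suc k) + 1) ^ 3 / 3 \<le> (real k + 1) ^ 3 / 3 + (real (Suc k) + 2)\<^sup>2"
    by (simp add: power2_eq_square power3_eq_cube field_simps)
  with Suc show ?case by simp
qed simp

theorem theorem6:
  fixes f :: "real ^ 'n \<Rightarrow> real"
    and x y :: "nat \<Rightarrow> real ^ 'n"
    and xstar :: "real ^ 'n"
    and L s :: real
  assumes "L > 0"
    and "f \<in> F1_class L"
    and "\<forall>z. f xstar \<le> f z"
    and "0 < s" and "s \<le> 1 / (3 * L)"
    and "x 0 = y 0"
    and "\<forall>k. y (Suc k) = x k - s *\<^sub>R gradient f (x k)"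
    and "\<forall>k. x (Suc k) = y (Suc k) + (real k / (real k + 3)) *\<^sub>R (y (Suc k) - y k)"
  shows "(\<forall>k. Min ((\<lambda>i. (norm (gradient f (x i)))\<^sup>2) ` {0..k})
              \<le> 8568 * (norm (x 0 - xstar))\<^sup>2 / (s\<^sup>2 * (real k + 1) ^ 3))
       \<and> (\<forall>k. f (x k) - f xstar
              \<le> 119 * (norm (x 0 - xstar))\<^sup>2 / (s * (real k + 1)\<^sup>2))"
proof -
  define g where "g k = gradient f (x k)" for k
  define t where "t k = (real k + 2) / 2" for k :: nat
  define u where "u k = t k *\<^sub>R x k - (t k - 1) *\<^sub>R y k - xstar" for k
  define E where "E k = 2 * s * ((t k)\<^sup>2 - t k) * (f (y k) - f xstar) + (norm (u k))\<^sup>2" for k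
  define D where "D = (norm (x 0 - xstar))\<^sup>2"
  \<comment> \<open>The energy right after a step, still with weight \<open>(t k)^2\<close> on the
    function gap and with the surplus gradient term that \<open>c = 2/3\<close> leaves.\<close>
  define S where "S k = 2 * s * (t k)\<^sup>2 * (f (y (Suc k)) - f xstar) + (norm (u (Suc k)))\<^sup>2
                        + 1/3 * s\<^sup>2 * (t k)\<^sup>2 * (norm (g k))\<^sup>2" for k
  have diff: "f differentiable_on UNIV" and conv: "convex_on UNIV f"
    and lip: "\<And>x y. norm (gradient f x - gradient f y) \<le> L * norm (x - y)"
    using assms(2) by (auto simp: F1_class_def)
  have min: "f xstar \<le> f z" for z using assms(3) by blast
  have "s * L \<le> 1 / 3" using assms(1,5) by (simp add: field_simps)
  have y_Suc: "y (Suc k) = x k - s *\<^sub>R g k" for k using assms(7) by (simp add: g_def)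
  have t_ge1: "1 \<le> t k" for k by (simp add: t_def)
  have decrease: "f (y (Suc k)) \<le> f (x k) - 2/3 * s * (norm (g k))\<^sup>2" for k
  proof -
    have "2/3 * s * (norm (g k))\<^sup>2 \<le> s * (1 - s * L) * (norm (g k))\<^sup>2"
      using \<open>s * L \<le> 1 / 3\<close> \<open>0 < s\<close> by (intro mult_right_mono) auto
    moreover have "f (y (Suc k)) \<le> f (x k) - s * (1 - s * L) * (norm (g k))\<^sup>2"
      unfolding y_Suc g_def using assms(1,4) by (intro gradient_step_decrease diff lip) auto
    ultimately show ?thesis by linarith
  qed
  have u_Suc: "u (Suc k) = u k - (s * t k) *\<^sub>R g k" for k
  proof -
    have "(t k - 1) / t (Suc k) = real k / (real k + 3)"
      by (simp add: t_def field_simps)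
    then have "x (Suc k) = y (Suc k) + ((t k - 1) / t (Suc k)) *\<^sub>R (y (Suc k) - y k)"
      using assms(8) by simp
    then show ?thesis
      using nesterov_momentum_step[of "t (Suc k)" "x (Suc k)" "y (Suc k)" "t k" "y k" xstar "x k"]
        t_ge1[of "Suc k"]
      by (simp add: u_def y_Suc mult.commute)
  qed
  have S_le_E: "S k \<le> E k" for k
  proof -
    have "f (y (Suc k)) - f z \<le> g k \<bullet> (x k - z) - 2/3 * s * (norm (g k))\<^sup>2" for z
      using decrease[of k] convex_on_gradient_le[OF diff conv, of "x k" z] by (simp add: g_def)
    from nesterov_energy_step[OF less_imp_le[OF \<open>0 < s\<close>] t_ge1[of k],
        of "f (y (Suc k)) - f xstar" "f (y k) - f xstar" "g k" "x k" "y k" "2/3" xstar]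
      this[of "y k"] this[of xstar]
    show ?thesis
      by (simp add: S_def E_def u_Suc) (simp add: u_def)
  qed
  have E_Suc: "E (Suc k) + 1/3 * s\<^sup>2 * (t k)\<^sup>2 * (norm (g k))\<^sup>2 \<le> S k" for k
  proof -
    \<comment> \<open>As \<open>t (Suc k) = t k + 1/2\<close>, the left side equals
      \<open>(t k)^2 - 1/4\<close>.\<close>
    have "(t (Suc k))\<^sup>2 - t (Suc k) \<le> (t k)\<^sup>2"
      by (simp add: t_def power2_eq_square field_simps)
    then have "2 * s * ((t (Suc k))\<^sup>2 - t (Suc k)) * (f (y (Suc k)) - f xstar)
        \<le> 2 * s * (t k)\<^sup>2 * (f (y (Suc k)) - f xstar)"
      using \<open>0 < s\<close> min by (intro mult_right_mono mult_left_mono) auto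
    then show ?thesis by (simp add: S_def E_def)
  qed
  have E_nonneg: "0 \<le> E k" for k
  proof -
    have "t k \<le> (t k)\<^sup>2" using t_ge1[of k] by (simp add: power2_eq_square)
    then show ?thesis using \<open>0 < s\<close> min by (simp add: E_def)
  qed
  \<comment> \<open>Since \<open>t 0 = 1\<close>, the function gap has weight 0 and
    \<open>u 0 = x 0 - xstar\<close>.\<close>
  have E_0: "E 0 = D" by (simp add: E_def D_def u_def t_def)
  have E_sum: "E (Suc k) + (\<Sum>i\<le>k. 1/3 * s\<^sup>2 * (t i)\<^sup>2 * (norm (g i))\<^sup>2) \<le> D" for k
  proof (induction k)
    case 0
    from S_le_E[of 0] E_Suc[of 0] E_0 show ?case by simp
  next
    case (Suc k)
    with S_le_E[of "Suc k"] E_Suc[of "Suc k"] show ?case by simp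
  qed
  have E_le: "E k \<le> D" for k
  proof (cases k)
    case 0
    then show ?thesis by (simp add: E_0)
  next
    case (Suc j)
    have "0 \<le> (\<Sum>i\<le>j. 1/3 * s\<^sup>2 * (t i)\<^sup>2 * (norm (g i))\<^sup>2)"
      by (intro sum_nonneg) simp
    with E_sum[of j] show ?thesis unfolding Suc by linarith
  qed
  have "0 \<le> D" by (simp add: D_def)
  have "Min ((\<lambda>i. (norm (gradient f (x i)))\<^sup>2) ` {0..k})
      \<le> 8568 * (norm (x 0 - xstar))\<^sup>2 / (s\<^sup>2 * (real k + 1) ^ 3)" for k
  proof -
    define m where "m = Min ((\<lambda>i. (norm (g i))\<^sup>2) ` {0..k})"
    have m_le: "m \<le> (norm (g i))\<^sup>2" if "i \<le> k" for i
      unfolding m_def using that by (intro Min_le) auto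
    have "m \<in> (\<lambda>i. (norm (g i))\<^sup>2) ` {0..k}"
      unfolding m_def by (intro Min_in) auto
    then have "0 \<le> m" by auto
    \<comment> \<open>The factor 1/12 is the surplus coefficient 1/3 times the 1/4 in
      \<open>(t i)^2 = (i + 2)^2 / 4\<close>; with the cubic bound this yields the constant
      36.\<close>
    have "(real k + 1) ^ 3 / 3 * (s\<^sup>2 / 12 * m) \<le> (\<Sum>i\<le>k. (real i + 2)\<^sup>2) * (s\<^sup>2 / 12 * m)"
      using \<open>0 \<le> m\<close> by (intro mult_right_mono sum_of_shifted_squares_ge) simp
    also have "\<dots> = (\<Sum>i\<le>k. 1/3 * s\<^sup>2 * (t i)\<^sup>2 * m)"
      unfolding sum_distrib_right by (intro sum.cong) (auto simp: t_def power_divide)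
    also have "\<dots> \<le> (\<Sum>i\<le>k. 1/3 * s\<^sup>2 * (t i)\<^sup>2 * (norm (g i))\<^sup>2)"
      by (intro sum_mono mult_left_mono m_le) auto
    also have "\<dots> \<le> D"
      using E_sum[of k] E_nonneg[of "Suc k"] by linarith
    finally have "m * (s\<^sup>2 * (real k + 1) ^ 3) \<le> 36 * D"
      by (simp add: field_simps)
    with \<open>0 \<le> D\<close> have "m * (s\<^sup>2 * (real k + 1) ^ 3) \<le> 8568 * D" by linarith
    then have "m \<le> 8568 * D / (s\<^sup>2 * (real k + 1) ^ 3)"
      using \<open>0 < s\<close> by (subst pos_le_divide_eq) (auto intro!: mult_pos_pos)
    then show ?thesis by (simp add: m_def g_def D_def)
  qed
  moreover have "f (x k) - f xstar \<le> 119 * (norm (x 0 - xstar))\<^sup>2 / (s * (real k + 1)\<^sup>2)" for k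
  proof -
    define \<delta> where "\<delta> = f (y (Suc k)) - f xstar"
    have "f (x k) - f (y (Suc k)) \<le> s * (norm (g k))\<^sup>2"
      using convex_on_gradient_le[OF diff conv, of "x k" "y (Suc k)"]
      by (simp add: y_Suc power2_norm_eq_inner flip: g_def)
    moreover have "0 \<le> \<delta>" using min by (simp add: \<delta>_def)
    \<comment> \<open>The coefficient 6 matches the proportions in \<open>S k\<close>: multiplied by
      \<open>s * (t k)^2\<close>, the right side is exactly three times \<open>S k\<close> without
      its norm term.\<close>
    ultimately have "f (x k) - f xstar \<le> 6 * \<delta> + s * (norm (g k))\<^sup>2"
      by (simp add: \<delta>_def)
    then have "s * (t k)\<^sup>2 * (f (x k) - f xstar) \<le> s * (t k)\<^sup>2 * (6 * \<delta> + s * (norm (g k))\<^sup>2)"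
      using \<open>0 < s\<close> by (intro mult_left_mono) auto
    also have "\<dots> = 3 * (S k - (norm (u (Suc k)))\<^sup>2)"
      by (simp add: S_def \<delta>_def power2_eq_square algebra_simps)
    also have "\<dots> \<le> 3 * S k" by simp
    also have "\<dots> \<le> 3 * D" using S_le_E[of k] E_le[of k] by simp
    finally have le: "s * (t k)\<^sup>2 * (f (x k) - f xstar) \<le> 3 * D" .
    \<comment> \<open>Here \<open>4 * (t k)^2 = (k + 2)^2\<close>, so the bound \<open>3 * D\<close>
      becomes \<open>12 * D\<close>.\<close>
    have "(real k + 1)\<^sup>2 \<le> 4 * (t k)\<^sup>2"
      by (simp add: t_def power_divide power_mono)
    then have "(s * (f (x k) - f xstar)) * (real k + 1)\<^sup>2 \<le> (s * (f (x k) - f xstar)) * (4 * (t k)\<^sup>2)"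
      using \<open>0 < s\<close> min by (intro mult_left_mono) auto
    also have "\<dots> \<le> 12 * D" using le by (simp add: mult_ac)
    also have "\<dots> \<le> 119 * D" using \<open>0 \<le> D\<close> by simp
    finally have "(f (x k) - f xstar) * (s * (real k + 1)\<^sup>2) \<le> 119 * D"
      by (simp add: mult_ac)
    then have "f (x k) - f xstar \<le> 119 * D / (s * (real k + 1)\<^sup>2)"
      using \<open>0 < s\<close> by (subst pos_le_divide_eq) (auto intro!: mult_pos_pos)
    then show ?thesis by (simp add: D_def)
  qed
  ultimately show ?thesis by blast
qed

end
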